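(* Let $M$ be a compact Riemannian manifold with $\dim M\ge2$, $r\ge1$, and let $f\in\mathrm{Diff}^r(M)$ have a uniformly hyperbolic invariant set $\Lambda$ which is the maximal $f$-invariant set in a disjoint union of $n\ge2$ open sets and such that $f|_\Lambda$ is topologically conjugate to the full two-sided shift on $n$ symbols. Let $x\in\Lambda$, let $g\in\mathrm{Diff}^r(M)$ be sufficiently $C^r$-close to $f$, with continuations $\Lambda_g$ of $\Lambda$ and $x_g\in\Lambda_g$ of $x$, and let $D$ be an open subset of $M$ with positive Lebesgue measure such that $$\lim_{m\to\infty}d_W(\delta^m_{y,g},\delta^m_{x_g,g})=0\qquad\text{for every }y\in D.$$ Then $D\cap\Lambda_g=\emptyset$.
   Context: For $y\in M$ and $g\in\mathrm{Diff}^r(M)$, the empirical measure is $\delta^m_{y,g}=\frac1m\sum_{i=0}^{m-1}\delta_{g^i(y)}$. For Borel probability measures $\mu,\nu$ on $M$, $d_W(\mu,\nu)=\sup_\varphi\left|\int_M\varphi\,d\mu-\int_M\varphi\,d\nu\right|$, where the supremum is over all Lipschitz functions $\varphi:M\to[-1,1]$ with Lipschitz constant at most $1$. Continuation means hyperbolic continuation: for $g$ $C^r$-close to $f$ there is a hyperbolic set $\Lambda_g$ close to $\Lambda$ and a conjugacy $h_g:\Lambda\to\Lambda_g$ close to the inclusion between $f|_\Lambda$ and $g|_{\Lambda_g}$; $x_g=h_g(x)$. Lebesgue measure is the Riemannian volume. *)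

theory Defs
  imports "HOL-Probability.Probability" "HOL-Library.Extended_Nat"
begin

section \<open>Differentiability of class C^k in Euclidean space\<close>

text \<open>Only meant for open \<open>S\<close>: all iterated directional derivatives up to order \<open>k\<close>
  exist and are continuous.\<close>

fun Ck_on :: "nat \<Rightarrow> 'a::euclidean_space set \<Rightarrow> ('a \<Rightarrow> 'b::real_normed_vector) \<Rightarrow> bool" where
  "Ck_on 0 S F \<longleftrightarrow> continuous_on S F"
| "Ck_on (Suc k) S F \<longleftrightarrow> (\<forall>z\<in>S. F differentiable (at z)) \<and>
     (\<forall>v. Ck_on k S (\<lambda>z. frechet_derivative F (at z) v))"

definition smooth_on :: "'a::euclidean_space set \<Rightarrow> ('a \<Rightarrow> 'b::real_normed_vector) \<Rightarrow> bool" where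
  "smooth_on S F \<longleftrightarrow> (\<forall>k. Ck_on k S F)"

fun iter_deriv :: "'a::euclidean_space list \<Rightarrow> ('a \<Rightarrow> 'b::real_normed_vector) \<Rightarrow> 'a \<Rightarrow> 'b" where
  "iter_deriv [] F = F"
| "iter_deriv (v # vs) F = iter_deriv vs (\<lambda>z. frechet_derivative F (at z) v)"

section \<open>Smooth manifolds\<close>

text \<open>The manifold is the whole (compact Hausdorff) type \<open>'m\<close>.  A chart is a pair of its domain
  and its coordinate map, whose values off the domain are irrelevant.\<close>

type_synonym ('m, 'n) chart = "'m set \<times> ('m \<Rightarrow> real ^ 'n)"

definition chart_inv :: "('m, 'n::finite) chart \<Rightarrow> real ^ 'n \<Rightarrow> 'm" where
  "chart_inv c = inv_into (fst c) (snd c)"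

definition local_rep ::
    "('m \<Rightarrow> 'm) \<Rightarrow> ('m, 'n::finite) chart \<Rightarrow> ('m, 'n) chart \<Rightarrow> real ^ 'n \<Rightarrow> real ^ 'n" where
  "local_rep f c d = snd d \<circ> f \<circ> chart_inv c"

definition local_dom ::
    "('m \<Rightarrow> 'm) \<Rightarrow> ('m, 'n::finite) chart \<Rightarrow> ('m, 'n) chart \<Rightarrow> (real ^ 'n) set" where
  "local_dom f c d = snd c ` {p \<in> fst c. f p \<in> fst d}"

text \<open>The matrix of the tangent map \<open>T\<^sub>p f\<close> in the charts \<open>c\<close> at \<open>p\<close> and \<open>d\<close> at \<open>f p\<close>,
  as a linear map; for \<open>f = id\<close> it is the change of coordinates on \<open>T\<^sub>p M\<close>.\<close>

definition tangent_map ::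
    "('m \<Rightarrow> 'm) \<Rightarrow> ('m, 'n::finite) chart \<Rightarrow> ('m, 'n) chart \<Rightarrow> 'm \<Rightarrow> real ^ 'n \<Rightarrow> real ^ 'n" where
  "tangent_map f c d p = frechet_derivative (local_rep f c d) (at (snd c p))"

definition smooth_atlas :: "('m::t2_space, 'n::finite) chart set \<Rightarrow> bool" where
  "smooth_atlas A \<longleftrightarrow>
     (\<Union>c\<in>A. fst c) = UNIV \<and>
     (\<forall>c\<in>A. open (fst c) \<and> open (snd c ` fst c) \<and>
        homeomorphism (fst c) (snd c ` fst c) (snd c) (chart_inv c)) \<and>
     (\<forall>c\<in>A. \<forall>d\<in>A. smooth_on (local_dom id c d) (local_rep id c d))"

section \<open>Riemannian metrics, distance and volume\<close>

text \<open>A Riemannian metric is given by its coordinate expressions: \<open>G c p\<close> is the inner product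
  on \<open>T\<^sub>p M\<close> read in the chart \<open>c\<close>.\<close>

type_synonym ('m, 'n) metric_tensor =
  "('m, 'n) chart \<Rightarrow> 'm \<Rightarrow> real ^ 'n \<Rightarrow> real ^ 'n \<Rightarrow> real"

definition riemannian_metric ::
    "('m::t2_space, 'n::finite) chart set \<Rightarrow> ('m, 'n) metric_tensor \<Rightarrow> bool" where
  "riemannian_metric A G \<longleftrightarrow>
     (\<forall>c\<in>A. \<forall>p\<in>fst c. bilinear (G c p) \<and> (\<forall>v w. G c p v w = G c p w v) \<and>
        (\<forall>v. v \<noteq> 0 \<longrightarrow> G c p v v > 0)) \<and>
     (\<forall>c\<in>A. \<forall>v w. smooth_on (snd c ` fst c) (\<lambda>z. G c (chart_inv c z) v w)) \<and>
     (\<forall>c\<in>A. \<forall>d\<in>A. \<forall>p\<in>fst c \<inter> fst d. \<forall>v w.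
        G c p v w = G d p (tangent_map id c d p v) (tangent_map id c d p w))"

definition compact_riemannian_manifold ::
    "('m::t2_space, 'n::finite) chart set \<Rightarrow> ('m, 'n) metric_tensor \<Rightarrow> bool" where
  "compact_riemannian_manifold A G \<longleftrightarrow>
     compact (UNIV :: 'm set) \<and> smooth_atlas A \<and> riemannian_metric A G"

definition tangent_norm ::
    "('m, 'n::finite) metric_tensor \<Rightarrow> ('m, 'n) chart \<Rightarrow> 'm \<Rightarrow> real ^ 'n \<Rightarrow> real" where
  "tangent_norm G c p v = sqrt (G c p v v)"

text \<open>Curves are parametrised by \<open>[0,1]\<close>; being C^1 on a subinterval \<open>[a,b]\<close> refers to one-sided
  derivatives at \<open>a\<close> and \<open>b\<close>.\<close>

definition C1_curve_on ::
    "('m, 'n::finite) chart set \<Rightarrow> (real \<Rightarrow> 'm) \<Rightarrow> real \<Rightarrow> real \<Rightarrow> bool" where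
  "C1_curve_on A \<gamma> a b \<longleftrightarrow> (\<forall>c\<in>A.
     (\<forall>t\<in>{a..b}. \<gamma> t \<in> fst c \<longrightarrow> (snd c \<circ> \<gamma>) differentiable (at t within {a..b})) \<and>
     continuous_on {t\<in>{a..b}. \<gamma> t \<in> fst c}
       (\<lambda>t. vector_derivative (snd c \<circ> \<gamma>) (at t within {a..b})))"

definition piecewise_C1_curve ::
    "('m::t2_space, 'n::finite) chart set \<Rightarrow> (real \<Rightarrow> 'm) \<Rightarrow> bool" where
  "piecewise_C1_curve A \<gamma> \<longleftrightarrow> continuous_on {0..1} \<gamma> \<and>
     (\<exists>S. finite S \<and> (\<forall>a b. 0 \<le> a \<and> a < b \<and> b \<le> 1 \<and> {a<..<b} \<inter> S = {} \<longrightarrow>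
        C1_curve_on A \<gamma> a b))"

text \<open>The speed does not depend on the chosen chart.  Its values at the finitely many
  corners are irrelevant for the length.\<close>

definition curve_speed ::
    "('m, 'n::finite) chart set \<Rightarrow> ('m, 'n) metric_tensor \<Rightarrow> (real \<Rightarrow> 'm) \<Rightarrow> real \<Rightarrow> real" where
  "curve_speed A G \<gamma> t = (let c = (SOME c. c \<in> A \<and> \<gamma> t \<in> fst c) in
     tangent_norm G c (\<gamma> t) (vector_derivative (snd c \<circ> \<gamma>) (at t within {0..1})))"

definition curve_length ::
    "('m, 'n::finite) chart set \<Rightarrow> ('m, 'n) metric_tensor \<Rightarrow> (real \<Rightarrow> 'm) \<Rightarrow> real" where
  "curve_length A G \<gamma> = integral {0..1} (curve_speed A G \<gamma>)"

text \<open>Extended-real valued, with distance \<open>\<infinity>\<close> between different components of \<open>M\<close>.\<close>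

definition riem_dist ::
    "('m::t2_space, 'n::finite) chart set \<Rightarrow> ('m, 'n) metric_tensor \<Rightarrow> 'm \<Rightarrow> 'm \<Rightarrow> ereal" where
  "riem_dist A G p q =
     (INF \<gamma>\<in>{\<gamma>. piecewise_C1_curve A \<gamma> \<and> \<gamma> 0 = p \<and> \<gamma> 1 = q}. ereal (curve_length A G \<gamma>))"

text \<open>The unique Borel measure with density \<open>sqrt (det (g\<^sub>i\<^sub>j))\<close> in every chart; it exists and is
  unique because finitely many charts cover a compact manifold.\<close>

definition riem_volume ::
    "('m::t2_space, 'n::finite) chart set \<Rightarrow> ('m, 'n) metric_tensor \<Rightarrow> 'm measure" where
  "riem_volume A G = (THE \<mu>. sets \<mu> = sets borel \<and>
     (\<forall>c\<in>A. \<forall>B\<in>sets borel. B \<subseteq> fst c \<longrightarrow>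
        emeasure \<mu> B = (\<integral>\<^sup>+z\<in>snd c ` B.
          ennreal (sqrt (det (\<chi> i j. G c (chart_inv c z) (axis i 1) (axis j 1)))) \<partial>lborel)))"

section \<open>Diffeomorphisms and the C^r topology\<close>

definition Cr_map ::
    "('m::t2_space, 'n::finite) chart set \<Rightarrow> enat \<Rightarrow> ('m \<Rightarrow> 'm) \<Rightarrow> bool" where
  "Cr_map A r f \<longleftrightarrow> continuous_on UNIV f \<and>
     (\<forall>c\<in>A. \<forall>d\<in>A. \<forall>k. enat k \<le> r \<longrightarrow> Ck_on k (local_dom f c d) (local_rep f c d))"

definition Diff :: "('m::t2_space, 'n::finite) chart set \<Rightarrow> enat \<Rightarrow> ('m \<Rightarrow> 'm) set" where
  "Diff A r = {f. bij f \<and> Cr_map A r f \<and> Cr_map A r (inv f)}"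

text \<open>The usual subbasic neighbourhoods: closeness on a compact piece \<open>K\<close> of a chart of all partial
  derivatives of order at most \<open>k\<close>.  For \<open>r = \<infinity>\<close> all finite orders \<open>k\<close> are used.\<close>

definition Cr_nbhd ::
    "('m::t2_space, 'n::finite) chart set \<Rightarrow> enat \<Rightarrow> ('m \<Rightarrow> 'm) \<Rightarrow> ('m, 'n) chart \<Rightarrow> ('m, 'n) chart
      \<Rightarrow> 'm set \<Rightarrow> nat \<Rightarrow> real \<Rightarrow> ('m \<Rightarrow> 'm) set" where
  "Cr_nbhd A r f c d K k \<epsilon> = {g \<in> Diff A r. g ` K \<subseteq> fst d \<and>
     (\<forall>z\<in>snd c ` K. \<forall>vs. set vs \<subseteq> Basis \<and> length vs \<le> k \<longrightarrow>
        norm (iter_deriv vs (local_rep g c d) z - iter_deriv vs (local_rep f c d) z) < \<epsilon>)}"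

definition Cr_topology ::
    "('m::t2_space, 'n::finite) chart set \<Rightarrow> enat \<Rightarrow> ('m \<Rightarrow> 'm) topology" where
  "Cr_topology A r = topology_generated_by
     {Cr_nbhd A r f c d K k \<epsilon> | f c d K k \<epsilon>.
        f \<in> Diff A r \<and> c \<in> A \<and> d \<in> A \<and> compact K \<and> K \<subseteq> fst c \<and> f ` K \<subseteq> fst d \<and>
        enat k \<le> r \<and> \<epsilon> > 0}"

section \<open>Hyperbolic sets and their continuations\<close>

text \<open>The subspaces \<open>Es c p\<close> and \<open>Eu c p\<close> are \<open>E\<^sup>s\<^sub>p\<close> and \<open>E\<^sup>u\<^sub>p\<close> read in the chart \<open>c\<close>.\<close>

definition hyperbolic_splitting ::
    "('m::t2_space, 'n::finite) chart set \<Rightarrow> ('m \<Rightarrow> 'm) \<Rightarrow> 'm set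
      \<Rightarrow> (('m, 'n) chart \<Rightarrow> 'm \<Rightarrow> (real ^ 'n) set) \<Rightarrow> (('m, 'n) chart \<Rightarrow> 'm \<Rightarrow> (real ^ 'n) set)
      \<Rightarrow> bool" where
  "hyperbolic_splitting A f \<Lambda> Es Eu \<longleftrightarrow>
     (\<forall>p\<in>\<Lambda>. \<forall>c\<in>A. p \<in> fst c \<longrightarrow>
        subspace (Es c p) \<and> subspace (Eu c p) \<and>
        Es c p \<inter> Eu c p = {0} \<and> {v + w | v w. v \<in> Es c p \<and> w \<in> Eu c p} = UNIV \<and>
        (\<forall>d\<in>A. p \<in> fst d \<longrightarrow>
           tangent_map id c d p ` Es c p = Es d p \<and> tangent_map id c d p ` Eu c p = Eu d p) \<and>
        (\<forall>d\<in>A. f p \<in> fst d \<longrightarrow>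
           tangent_map f c d p ` Es c p = Es d (f p) \<and>
           tangent_map f c d p ` Eu c p = Eu d (f p)))"

definition contracted_by ::
    "('m::t2_space, 'n::finite) chart set \<Rightarrow> ('m, 'n) metric_tensor \<Rightarrow> ('m \<Rightarrow> 'm) \<Rightarrow> 'm set
      \<Rightarrow> (('m, 'n) chart \<Rightarrow> 'm \<Rightarrow> (real ^ 'n) set) \<Rightarrow> real \<Rightarrow> real \<Rightarrow> bool" where
  "contracted_by A G f \<Lambda> E C lam \<longleftrightarrow>
     (\<forall>p\<in>\<Lambda>. \<forall>k. \<forall>c\<in>A. \<forall>d\<in>A. p \<in> fst c \<and> (f ^^ k) p \<in> fst d \<longrightarrow>
        (\<forall>v\<in>E c p. tangent_norm G d ((f ^^ k) p) (tangent_map (f ^^ k) c d p v)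
                     \<le> C * lam ^ k * tangent_norm G c p v))"

definition hyperbolic_set ::
    "('m::t2_space, 'n::finite) chart set \<Rightarrow> ('m, 'n) metric_tensor \<Rightarrow> ('m \<Rightarrow> 'm) \<Rightarrow> 'm set \<Rightarrow> bool"
  where
  "hyperbolic_set A G f \<Lambda> \<longleftrightarrow> compact \<Lambda> \<and> f ` \<Lambda> = \<Lambda> \<and>
     (\<exists>Es Eu C lam. C > 0 \<and> 0 < lam \<and> lam < 1 \<and> hyperbolic_splitting A f \<Lambda> Es Eu \<and>
        contracted_by A G f \<Lambda> Es C lam \<and> contracted_by A G (inv f) \<Lambda> Eu C lam)"

definition maximal_invariant_set :: "('m \<Rightarrow> 'm) \<Rightarrow> 'm set \<Rightarrow> 'm set \<Rightarrow> bool" where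
  "maximal_invariant_set f V \<Lambda> \<longleftrightarrow>
     f ` \<Lambda> = \<Lambda> \<and> \<Lambda> \<subseteq> V \<and> (\<forall>N. f ` N = N \<and> N \<subseteq> V \<longrightarrow> N \<subseteq> \<Lambda>)"

definition full_shift_space :: "nat \<Rightarrow> (int \<Rightarrow> nat) topology" where
  "full_shift_space n = product_topology (\<lambda>_. discrete_topology {..<n}) UNIV"

definition shift :: "(int \<Rightarrow> nat) \<Rightarrow> int \<Rightarrow> nat" where
  "shift a = (\<lambda>i. a (i + 1))"

definition conjugate_to_full_shift ::
    "('m::topological_space \<Rightarrow> 'm) \<Rightarrow> 'm set \<Rightarrow> nat \<Rightarrow> bool" where
  "conjugate_to_full_shift f \<Lambda> n \<longleftrightarrow>
     (\<exists>\<theta>. homeomorphic_map (top_of_set \<Lambda>) (full_shift_space n) \<theta> \<and>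
          (\<forall>p\<in>\<Lambda>. \<theta> (f p) = shift (\<theta> p)))"

text \<open>\<open>\<Lambda>g\<close> is a hyperbolic set of \<open>g\<close> and \<open>h\<close> a conjugacy from \<open>f\<close> on \<open>\<Lambda>\<close> to \<open>g\<close> on \<open>\<Lambda>g\<close> that is
  \<open>\<epsilon>\<close>-close to the inclusion (which also bounds the Hausdorff distance of \<open>\<Lambda>\<close> and \<open>\<Lambda>g\<close>).  For small
  \<open>\<epsilon>\<close> and \<open>g\<close> close to \<open>f\<close> this determines \<open>\<Lambda>g\<close> and \<open>h\<close> on \<open>\<Lambda>\<close>.\<close>

definition hyperbolic_continuation ::
    "('m::t2_space, 'n::finite) chart set \<Rightarrow> ('m, 'n) metric_tensor \<Rightarrow> ('m \<Rightarrow> 'm) \<Rightarrow> 'm set \<Rightarrow> real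
      \<Rightarrow> ('m \<Rightarrow> 'm) \<Rightarrow> 'm set \<Rightarrow> ('m \<Rightarrow> 'm) \<Rightarrow> bool" where
  "hyperbolic_continuation A G f \<Lambda> \<epsilon> g \<Lambda>g h \<longleftrightarrow>
     hyperbolic_set A G g \<Lambda>g \<and>
     (\<exists>h'. homeomorphism \<Lambda> \<Lambda>g h h') \<and>
     (\<forall>p\<in>\<Lambda>. h (f p) = g (h p)) \<and>
     (\<forall>p\<in>\<Lambda>. riem_dist A G p (h p) < ereal \<epsilon>)"

section \<open>Empirical measures and the Wasserstein distance\<close>

definition empirical_measure :: "nat \<Rightarrow> 'm::topological_space \<Rightarrow> ('m \<Rightarrow> 'm) \<Rightarrow> 'm measure" where
  "empirical_measure m y g = measure_of UNIV (sets borel)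
     (\<lambda>B. (\<Sum>i<m. emeasure (return borel ((g ^^ i) y)) B) / of_nat m)"

definition lipschitz1_functions ::
    "('m::t2_space, 'n::finite) chart set \<Rightarrow> ('m, 'n) metric_tensor \<Rightarrow> ('m \<Rightarrow> real) set" where
  "lipschitz1_functions A G =
     {\<phi>. range \<phi> \<subseteq> {-1..1} \<and> (\<forall>p q. ereal \<bar>\<phi> p - \<phi> q\<bar> \<le> riem_dist A G p q)}"

definition wasserstein ::
    "('m::t2_space, 'n::finite) chart set \<Rightarrow> ('m, 'n) metric_tensor \<Rightarrow> 'm measure \<Rightarrow> 'm measure \<Rightarrow> real"
  where
  "wasserstein A G \<mu> \<nu> =
     (SUP \<phi>\<in>lipschitz1_functions A G. \<bar>(\<integral>p. \<phi> p \<partial>\<mu>) - (\<integral>p. \<phi> p \<partial>\<nu>)\<bar>)"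

end

theory Submission
  imports Defs
begin

text \<open>If \<open>D\<close> met \<open>\<Lambda>g\<close>, then, replacing far right tails of a symbol sequence by constant ones, \<open>D\<close>
  would contain points of \<open>\<Lambda>g\<close> that are forward asymptotic to the fixed points \<open>0\<^sup>\<infinity>\<close> and \<open>1\<^sup>\<infinity>\<close>
  of the shift.  Their empirical measures converge to two different Dirac measures, while the
  hypothesis makes both asymptotic to the same sequence.  Two points of \<open>M\<close> are separated by a
  Lipschitz function supported in a chart, because a function of class \<open>C\<^sup>1\<close> whose gradient has norm
  at most 1 is 1-Lipschitz for the Riemannian distance.\<close>

section \<open>Lipschitz functions for the Riemannian distance\<close>

lemma smooth_on_imp_continuous_on: "smooth_on S F \<Longrightarrow> continuous_on S F"
  unfolding smooth_on_def by (metis Ck_on.simps(1))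

lemma smooth_on_imp_differentiable: "smooth_on S F \<Longrightarrow> z \<in> S \<Longrightarrow> F differentiable (at z)"
  unfolding smooth_on_def by (metis Ck_on.simps(2))

lemma smooth_atlasD:
  assumes "smooth_atlas A" "c \<in> A"
  shows "open (fst c)" "open (snd c ` fst c)" "continuous_on (fst c) (snd c)"
    "continuous_on (snd c ` fst c) (chart_inv c)"
    "\<And>p. p \<in> fst c \<Longrightarrow> chart_inv c (snd c p) = p"
  using assms unfolding smooth_atlas_def
  by (auto dest: homeomorphism_cont1 homeomorphism_cont2 homeomorphism_apply1)

lemma smooth_atlas_chart:
  assumes "smooth_atlas A"
  obtains c where "c \<in> A" "p \<in> fst c"
  using assms unfolding smooth_atlas_def by blast

lemma riemannian_metricD:
  assumes "riemannian_metric A G" "c \<in> A" "p \<in> fst c"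
  shows "bilinear (G c p)" "v \<noteq> 0 \<Longrightarrow> G c p v v > 0"
  using assms unfolding riemannian_metric_def by blast+

lemma tangent_norm_nonneg:
  assumes "riemannian_metric A G" "c \<in> A" "p \<in> fst c"
  shows "0 \<le> tangent_norm G c p v"
proof -
  have "G c p v v \<ge> 0"
    using riemannian_metricD(2)[OF assms, of v] bilinear_lzero[OF riemannian_metricD(1)[OF assms], of v]
    by (cases "v = 0") auto
  then show ?thesis by (simp add: tangent_norm_def)
qed

text \<open>A smooth metric is by definition smooth in the base point for fixed vectors only.
  Expanding both arguments in \<open>Basis\<close> turns the joint dependence into a finite sum of
  products of continuous functions. Applied to velocities of curves and, for a compactness argument,
  to base points and unit vectors.\<close>

lemma continuous_on_metric_tensor:
  assumes A: "smooth_atlas A" "riemannian_metric A G" "c \<in> A"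
    and \<pi>: "continuous_on X \<pi>" "\<pi> ` X \<subseteq> fst c"
    and vw: "continuous_on X v" "continuous_on X w"
  shows "continuous_on X (\<lambda>x. G c (\<pi> x) (v x) (w x))"
proof -
  have *: "continuous_on X (\<lambda>x. G c (\<pi> x) a b)" for a b
  proof -
    have "continuous_on (snd c ` fst c) (\<lambda>z. G c (chart_inv c z) a b)"
      using A unfolding riemannian_metric_def by (blast intro: smooth_on_imp_continuous_on)
    moreover have "continuous_on X (\<lambda>x. snd c (\<pi> x))"
      using continuous_on_compose2[OF smooth_atlasD(3)[OF A(1,3)] \<pi>] .
    ultimately have "continuous_on X (\<lambda>x. G c (chart_inv c (snd c (\<pi> x))) a b)"
      by (rule continuous_on_compose2) (use \<pi> in auto)
    then show ?thesis
      by (rule continuous_on_eq) (use \<pi> smooth_atlasD(5)[OF A(1,3)] in auto)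
  qed
  have "continuous_on X (\<lambda>x. \<Sum>(i, j)\<in>Basis \<times> Basis. (v x \<bullet> i) * ((w x \<bullet> j) * G c (\<pi> x) i j))"
    unfolding case_prod_unfold by (intro continuous_intros * vw)
  then show ?thesis
  proof (rule continuous_on_eq)
    fix x assume "x \<in> X"
    then have bil: "bilinear (G c (\<pi> x))"
      using \<pi>(2) by (intro riemannian_metricD(1)[OF A(2,3)]) auto
    have "G c (\<pi> x) (v x) (w x) =
        G c (\<pi> x) (\<Sum>i\<in>Basis. (v x \<bullet> i) *\<^sub>R i) (\<Sum>j\<in>Basis. (w x \<bullet> j) *\<^sub>R j)"
      by (simp add: euclidean_representation)
    also have "\<dots> = (\<Sum>(i, j)\<in>Basis \<times> Basis. (v x \<bullet> i) * ((w x \<bullet> j) * G c (\<pi> x) i j))"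
      by (subst bilinear_sum[OF bil])
        (simp add: bilinear_lmul[OF bil] bilinear_rmul[OF bil] mult.left_commute)
    finally show "(\<Sum>(i, j)\<in>Basis \<times> Basis. (v x \<bullet> i) * ((w x \<bullet> j) * G c (\<pi> x) i j)) =
        G c (\<pi> x) (v x) (w x)" by simp
  qed
qed

section \<open>Speed and length of curves, and the Lipschitz criterion\<close>

lemma continuous_on_interval_ball_into_open:
  assumes "continuous_on {a..b} \<gamma>" "open U" "t \<in> {a..b}" "\<gamma> t \<in> U"
  obtains e where "e > 0" "\<And>s. s \<in> {a..b} \<Longrightarrow> dist s t < e \<Longrightarrow> \<gamma> s \<in> U"
proof -
  have "\<forall>\<^sub>F s in at t within {a..b}. \<gamma> s \<in> U"
    using assms topological_tendstoD unfolding continuous_on_def by blast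
  then obtain e where "e > 0" "\<And>s. s \<in> {a..b} \<Longrightarrow> s \<noteq> t \<Longrightarrow> dist s t < e \<Longrightarrow> \<gamma> s \<in> U"
    unfolding eventually_at by blast
  then show thesis using that assms(4) by metis
qed

text \<open>By the chain rule the derivative of the change of coordinates carries one coordinate
  velocity to the other, and the metric is invariant under exactly this linear map. Derivatives are
  taken within \<open>{a..b}\<close> so that the endpoints are covered.\<close>

lemma tangent_norm_curve_chart_independent:
  assumes A: "smooth_atlas A" "riemannian_metric A G" and c: "c \<in> A" and d: "d \<in> A"
    and \<gamma>: "continuous_on {a..b} \<gamma>" "C1_curve_on A \<gamma> a b" and "a < b"
    and t: "t \<in> {a..b}" "\<gamma> t \<in> fst c" "\<gamma> t \<in> fst d"
  shows "tangent_norm G c (\<gamma> t) (vector_derivative (snd c \<circ> \<gamma>) (at t within {a..b})) =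
    tangent_norm G d (\<gamma> t) (vector_derivative (snd d \<circ> \<gamma>) (at t within {a..b}))"
proof -
  define v where "v = vector_derivative (snd c \<circ> \<gamma>) (at t within {a..b})"
  let ?T = "tangent_map id c d (\<gamma> t)"
  have v: "((snd c \<circ> \<gamma>) has_vector_derivative v) (at t within {a..b})"
    using \<gamma>(2) c t vector_derivative_works unfolding C1_curve_on_def v_def by blast
  have "snd c (\<gamma> t) \<in> local_dom id c d" using t by (auto simp: local_dom_def)
  then have "local_rep id c d differentiable (at (snd c (\<gamma> t)))"
    using A c d smooth_on_imp_differentiable unfolding smooth_atlas_def by blast
  then have "(local_rep id c d has_derivative ?T) (at ((snd c \<circ> \<gamma>) t) within (snd c \<circ> \<gamma>) ` {a..b})"
    unfolding tangent_map_def
    by (simp add: frechet_derivative_works has_derivative_at_withinI)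
  from vector_derivative_diff_chain_within[OF v this]
  have chain: "((local_rep id c d \<circ> (snd c \<circ> \<gamma>)) has_vector_derivative ?T v) (at t within {a..b})" .
  obtain e where e: "e > 0" "\<And>s. s \<in> {a..b} \<Longrightarrow> dist s t < e \<Longrightarrow> \<gamma> s \<in> fst c"
    using continuous_on_interval_ball_into_open[OF \<gamma>(1) smooth_atlasD(1)[OF A(1) c] t(1,2)] by blast
  \<comment> \<open>Only near \<open>t\<close> does the curve stay in the domain of
    \<open>c\<close>, and only there is the composite in \<open>chain\<close> equal to
    \<open>snd d \<circ> \<gamma>\<close>; the derivative is therefore transferred on a ball of
    radius \<open>e\<close>.\<close>
  have "((snd d \<circ> \<gamma>) has_vector_derivative ?T v) (at t within {a..b})"
    unfolding has_vector_derivative_def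
    by (rule has_derivative_transform_within[OF chain[unfolded has_vector_derivative_def] e(1) t(1)])
      (use smooth_atlasD(5)[OF A(1) c] e(2) in \<open>auto simp: local_rep_def\<close>)
  then have "vector_derivative (snd d \<circ> \<gamma>) (at t within {a..b}) = ?T v"
    using \<open>a < b\<close> t(1) by (intro vector_derivative_within_closed_interval) auto
  moreover have "G c (\<gamma> t) v v = G d (\<gamma> t) (?T v) (?T v)"
    using A(2) c d t unfolding riemannian_metric_def by blast
  ultimately show ?thesis by (simp add: tangent_norm_def v_def)
qed

text \<open>The choice made inside \<open>curve_speed\<close>, named so that its properties can be
  stated.\<close>

definition some_chart :: "('m, 'n::finite) chart set \<Rightarrow> 'm \<Rightarrow> ('m, 'n) chart" where
  "some_chart A p = (SOME c. c \<in> A \<and> p \<in> fst c)"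

lemma some_chart:
  assumes "smooth_atlas A"
  shows "some_chart A p \<in> A" "p \<in> fst (some_chart A p)"
proof -
  have "\<exists>c. c \<in> A \<and> p \<in> fst c" using smooth_atlas_chart[OF assms] by metis
  from someI_ex[OF this] show "some_chart A p \<in> A" "p \<in> fst (some_chart A p)"
    unfolding some_chart_def by auto
qed

lemma curve_speed_eq:
  "curve_speed A G \<gamma> t = tangent_norm G (some_chart A (\<gamma> t)) (\<gamma> t)
     (vector_derivative (snd (some_chart A (\<gamma> t)) \<circ> \<gamma>) (at t within {0..1}))"
  by (simp add: curve_speed_def some_chart_def Let_def)

lemma curve_speed_nonneg:
  assumes "smooth_atlas A" "riemannian_metric A G"
  shows "0 \<le> curve_speed A G \<gamma> t"
  unfolding curve_speed_eq by (rule tangent_norm_nonneg[OF assms(2) some_chart[OF assms(1)]])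

text \<open>At an interior point the derivatives within \<open>{a..b}\<close> and within
  \<open>{0..1}\<close> are both the two-sided derivative, so chart independence on
  \<open>{a..b}\<close> speaks about the speed itself.\<close>

lemma curve_speed_chart:
  assumes A: "smooth_atlas A" "riemannian_metric A G" and c: "c \<in> A" "\<gamma> t \<in> fst c"
    and \<gamma>: "continuous_on {0..1} \<gamma>" "C1_curve_on A \<gamma> a b"
    and ab: "0 \<le> a" "b \<le> 1" "t \<in> {a<..<b}"
  shows "curve_speed A G \<gamma> t = tangent_norm G c (\<gamma> t) (vector_derivative (snd c \<circ> \<gamma>) (at t))"
proof -
  have int: "at t within {a..b} = at t" "at t within {0..1} = at t"
    using ab by (auto intro!: at_within_interior)
  have "continuous_on {a..b} \<gamma>" using \<gamma>(1) ab by (auto intro: continuous_on_subset)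
  from tangent_norm_curve_chart_independent[OF A some_chart(1)[OF A(1)] c(1) this \<gamma>(2) _ _ some_chart(2)[OF A(1)] c(2)]
  show ?thesis using ab by (simp add: curve_speed_eq int)
qed

text \<open>With derivatives taken within \<open>{a..b}\<close> the speed is continuous up to the
  endpoints. \<open>curve_speed\<close> takes them within \<open>{0..1}\<close> and can differ only
  at \<open>a\<close> and \<open>b\<close>, which the integral ignores.\<close>

lemma curve_speed_integrable_C1:
  assumes A: "smooth_atlas A" "riemannian_metric A G"
    and \<gamma>: "continuous_on {0..1} \<gamma>" "C1_curve_on A \<gamma> a b"
    and ab: "0 \<le> a" "a < b" "b \<le> 1"
  shows "curve_speed A G \<gamma> integrable_on {a..b}"
proof -
  let ?v = "\<lambda>c t. vector_derivative (snd c \<circ> \<gamma>) (at t within {a..b})"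
  define s where "s t = tangent_norm G (some_chart A (\<gamma> t)) (\<gamma> t) (?v (some_chart A (\<gamma> t)) t)" for t
  have \<gamma>ab: "continuous_on {a..b} \<gamma>" using \<gamma>(1) ab by (auto intro: continuous_on_subset)
  have "continuous (at t within {a..b}) s" if t: "t \<in> {a..b}" for t
  proof -
    \<comment> \<open>The chart in \<open>s\<close> may jump with the parameter. Continuity at
      \<open>t\<close> is checked in one fixed chart \<open>c\<close>, which computes the same
      values as \<open>s\<close> wherever the curve is in its domain.\<close>
    obtain c where c: "c \<in> A" "\<gamma> t \<in> fst c" using smooth_atlas_chart[OF A(1)] .
    let ?X = "{t\<in>{a..b}. \<gamma> t \<in> fst c}"
    have "continuous_on ?X (?v c)" using \<gamma>(2) c unfolding C1_curve_on_def by blast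
    then have "continuous_on ?X (\<lambda>t. tangent_norm G c (\<gamma> t) (?v c t))"
      unfolding tangent_norm_def
      by (intro continuous_on_real_sqrt continuous_on_metric_tensor[OF A c(1)] continuous_on_subset[OF \<gamma>ab]) auto
    then have "continuous_on ?X s"
      by (rule continuous_on_eq)
        (use tangent_norm_curve_chart_independent[OF A c(1) some_chart(1)[OF A(1)] \<gamma>ab \<gamma>(2) ab(2)]
          some_chart(2)[OF A(1)] in \<open>auto simp: s_def\<close>)
    then have X: "continuous (at t within ?X) s"
      using t c by (simp add: continuous_on_eq_continuous_within)
    obtain e where e: "e > 0" "\<And>s. s \<in> {a..b} \<Longrightarrow> dist s t < e \<Longrightarrow> \<gamma> s \<in> fst c"
      using continuous_on_interval_ball_into_open[OF \<gamma>ab smooth_atlasD(1)[OF A(1) c(1)] t c(2)] by blast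
    have "at t within ?X = at t within {a..b}"
      by (rule at_within_nhd[of _ "ball t e"]) (use e in \<open>auto simp: dist_commute\<close>)
    with X show ?thesis by simp
  qed
  then have "s integrable_on {a..b}"
    by (intro integrable_continuous_real) (simp add: continuous_on_eq_continuous_within)
  moreover have "curve_speed A G \<gamma> t = s t" if "t \<in> {a..b} - {a, b}" for t
  proof -
    have "at t within {a..b} = at t" "at t within {0..1} = at t"
      using ab that by (auto intro!: at_within_interior)
    then show ?thesis by (simp add: curve_speed_eq s_def)
  qed
  ultimately show ?thesis using integrable_spike_finite[of "{a, b}" "{a..b}"] by blast
qed

lemma finite_gap:
  fixes S :: "real set"
  assumes "finite S"
  obtains e where "e > 0" "ball t e \<inter> S \<subseteq> {t}"
proof -
  obtain e where e: "e > 0" "\<forall>s\<in>S. s \<noteq> t \<longrightarrow> e \<le> dist t s"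
    using finite_set_avoid[OF assms] by blast
  show thesis
  proof (rule that[OF e(1)])
    show "ball t e \<inter> S \<subseteq> {t}" using e(2) by (auto simp: not_le[symmetric])
  qed
qed

text \<open>Integrability is local on a compact interval. A small interval around \<open>t\<close>
  has at most the corner \<open>t\<close>, and cutting it there leaves two pieces without interior
  corners.\<close>

lemma curve_speed_integrable:
  assumes A: "smooth_atlas A" "riemannian_metric A G" and \<gamma>: "piecewise_C1_curve A \<gamma>"
  shows "curve_speed A G \<gamma> integrable_on {0..1}"
proof -
  obtain S where cont: "continuous_on {0..1} \<gamma>" and S: "finite S"
    "\<And>a b. 0 \<le> a \<Longrightarrow> a < b \<Longrightarrow> b \<le> 1 \<Longrightarrow> {a<..<b} \<inter> S = {} \<Longrightarrow> C1_curve_on A \<gamma> a b"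
    using \<gamma> unfolding piecewise_C1_curve_def by blast
  have piece: "curve_speed A G \<gamma> integrable_on {a..b}"
    if "0 \<le> a" "a \<le> b" "b \<le> 1" "{a<..<b} \<inter> S = {}" for a b
  proof (cases "a = b")
    case True
    then show ?thesis using integrable_on_refl[of "curve_speed A G \<gamma>" b] by simp
  next
    case False
    with that show ?thesis by (intro curve_speed_integrable_C1 A cont S) auto
  qed
  have "curve_speed A G \<gamma> integrable_on cbox 0 1"
  proof (rule integrable_on_little_subintervals, rule ballI)
    fix t :: real assume "t \<in> cbox 0 1"
    obtain e where e: "e > 0" "ball t e \<inter> S \<subseteq> {t}" using finite_gap[OF S(1)] .
    have "curve_speed A G \<gamma> integrable_on cbox u v"
      if uv: "t \<in> cbox u v" "cbox u v \<subseteq> ball t e" "cbox u v \<subseteq> cbox 0 1" for u v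
    proof -
      have le: "u \<le> t" "t \<le> v" "0 \<le> u" "v \<le> 1" using uv by (auto simp: subset_iff)
      have gap: "s = t" if "s \<in> S" "u \<le> s" "s \<le> v" for s
      proof -
        have "s \<in> cbox u v" using that by simp
        then show ?thesis using that(1) uv(2) e(2) by blast
      qed
      have "{u<..<t} \<inter> S = {}" "{t<..<v} \<inter> S = {}"
        using le by (auto dest!: gap)
      then have "curve_speed A G \<gamma> integrable_on {u..t}" "curve_speed A G \<gamma> integrable_on {t..v}"
        using le by (auto intro!: piece)
      from Henstock_Kurzweil_Integration.integrable_combine[OF le(1,2) this] show ?thesis by simp
    qed
    with e(1) show "\<exists>d>0. \<forall>u v. t \<in> cbox u v \<and> cbox u v \<subseteq> ball t d \<and> cbox u v \<subseteq> cbox 0 1 \<longrightarrow>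
        curve_speed A G \<gamma> integrable_on cbox u v" by blast
  qed
  then show ?thesis by simp
qed

text \<open>The chain rule and the gradient bound show that \<open>\<phi>\<close> changes along a
  curve no faster than the speed. Integrating bounds the total change by the length, and the infimum
  over curves gives the distance. The chart used for the derivative may vary with the point.\<close>

lemma lipschitz1_functionsI:
  assumes A: "smooth_atlas A" "riemannian_metric A G"
    and \<phi>: "continuous_on UNIV \<phi>" "range \<phi> \<subseteq> {-1..1}"
    and deriv: "\<And>p. \<exists>c\<in>A. p \<in> fst c \<and> (\<exists>\<phi>'. ((\<phi> \<circ> chart_inv c) has_derivative \<phi>') (at (snd c p)) \<and>
      (\<forall>v. \<bar>\<phi>' v\<bar> \<le> tangent_norm G c p v))"
  shows "\<phi> \<in> lipschitz1_functions A G"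
proof -
  have "\<bar>\<phi> (\<gamma> 1) - \<phi> (\<gamma> 0)\<bar> \<le> curve_length A G \<gamma>" if \<gamma>: "piecewise_C1_curve A \<gamma>" for \<gamma>
  proof -
    obtain S where cont: "continuous_on {0..1} \<gamma>" and S: "finite S"
      "\<And>a b. 0 \<le> a \<Longrightarrow> a < b \<Longrightarrow> b \<le> 1 \<Longrightarrow> {a<..<b} \<inter> S = {} \<Longrightarrow> C1_curve_on A \<gamma> a b"
      using \<gamma> unfolding piecewise_C1_curve_def by blast
    have ex: "\<exists>D. ((\<phi> \<circ> \<gamma>) has_vector_derivative D) (at t) \<and> \<bar>D\<bar> \<le> curve_speed A G \<gamma> t"
      if t: "t \<in> {0<..<1} - S" for t
    proof -
      obtain e where e: "e > 0" "ball t e \<inter> S \<subseteq> {t}" using finite_gap[OF S(1)] .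
      \<comment> \<open>A window around \<open>t\<close>, clipped to the unit interval. It contains
        no corner, since \<open>t\<close> is not one and \<open>e\<close> excludes all
        others.\<close>
      define a b where "a = max 0 (t - e)" and "b = min 1 (t + e)"
      have ab: "0 \<le> a" "b \<le> 1" "t \<in> {a<..<b}" using t e(1) by (auto simp: a_def b_def)
      have "{a<..<b} \<subseteq> ball t e" by (auto simp: a_def b_def dist_real_def)
      then have C1: "C1_curve_on A \<gamma> a b" using e(2) t ab by (intro S) auto
      have int: "at t within {a..b} = at t" using ab by (auto intro!: at_within_interior)
      obtain c \<phi>' where c: "c \<in> A" "\<gamma> t \<in> fst c"
        and \<phi>': "((\<phi> \<circ> chart_inv c) has_derivative \<phi>') (at (snd c (\<gamma> t)))"
          "\<And>v. \<bar>\<phi>' v\<bar> \<le> tangent_norm G c (\<gamma> t) v"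
        using deriv by metis
      define v where "v = vector_derivative (snd c \<circ> \<gamma>) (at t)"
      have "(snd c \<circ> \<gamma>) differentiable (at t within {a..b})"
        using C1 c ab unfolding C1_curve_on_def by auto
      then have "((snd c \<circ> \<gamma>) has_vector_derivative v) (at t)"
        unfolding v_def int by (simp add: vector_derivative_works)
      moreover have "((\<phi> \<circ> chart_inv c) has_derivative \<phi>')
          (at ((snd c \<circ> \<gamma>) t) within (snd c \<circ> \<gamma>) ` UNIV)"
        using \<phi>'(1) by (simp add: has_derivative_at_withinI)
      ultimately have chain:
        "((\<phi> \<circ> chart_inv c \<circ> (snd c \<circ> \<gamma>)) has_vector_derivative \<phi>' v) (at t within {a..b})"
        unfolding int by (rule vector_derivative_diff_chain_within)
      have \<gamma>ab: "continuous_on {a..b} \<gamma>" using cont ab by (auto intro: continuous_on_subset)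
      have tab: "t \<in> {a..b}" using ab by auto
      obtain \<epsilon> where \<epsilon>: "\<epsilon> > 0" "\<And>s. s \<in> {a..b} \<Longrightarrow> dist s t < \<epsilon> \<Longrightarrow> \<gamma> s \<in> fst c"
        using continuous_on_interval_ball_into_open[OF \<gamma>ab smooth_atlasD(1)[OF A(1) c(1)] tab c(2)] by blast
      have "((\<phi> \<circ> \<gamma>) has_vector_derivative \<phi>' v) (at t within {a..b})"
        unfolding has_vector_derivative_def
        by (rule has_derivative_transform_within[OF chain[unfolded has_vector_derivative_def] \<epsilon>(1) tab])
          (use smooth_atlasD(5)[OF A(1) c(1)] \<epsilon>(2) in auto)
      moreover have "curve_speed A G \<gamma> t = tangent_norm G c (\<gamma> t) v"
        unfolding v_def by (intro curve_speed_chart[where c=c and a=a and b=b] A c cont C1 ab)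
      ultimately show ?thesis using \<phi>'(2) by (auto simp: int)
    qed
    \<comment> \<open>The value 0 at corners and outside the open interval keeps \<open>D\<close>
      below the speed everywhere, because the speed is nonnegative.\<close>
    define D where "D t = (if t \<in> {0<..<1} - S then vector_derivative (\<phi> \<circ> \<gamma>) (at t) else 0)" for t
    have D: "((\<phi> \<circ> \<gamma>) has_vector_derivative D t) (at t)" if "t \<in> {0<..<1} - S" for t
      using ex[OF that] that by (auto simp: D_def vector_derivative_at)
    have "\<bar>D t\<bar> \<le> curve_speed A G \<gamma> t" for t
      using ex[of t] curve_speed_nonneg[OF A] by (auto simp: D_def vector_derivative_at)
    moreover have FTC: "(D has_integral ((\<phi> \<circ> \<gamma>) 1 - (\<phi> \<circ> \<gamma>) 0)) {0..1}"
    \<comment> \<open>This form allows the finitely many corners as exceptional points and asks only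
      for continuity at the ends.\<close>
    proof (rule fundamental_theorem_of_calculus_interior_strong[OF S(1) _ D])
      show "continuous_on {0..1} (\<phi> \<circ> \<gamma>)"
        using continuous_on_compose[OF cont continuous_on_subset[OF \<phi>(1)]] by simp
    qed simp
    ultimately have "norm (integral {0..1} D) \<le> integral {0..1} (curve_speed A G \<gamma>)"
      by (intro Henstock_Kurzweil_Integration.integral_norm_bound_integral
          has_integral_integrable curve_speed_integrable A \<gamma>) auto
    then show ?thesis using integral_unique[OF FTC] by (simp add: curve_length_def)
  qed
  \<comment> \<open>If no curve joins the points, the infimum is infinite and the bound is
    trivial.\<close>
  then have "ereal \<bar>\<phi> p - \<phi> q\<bar> \<le> riem_dist A G p q" for p q
    unfolding riem_dist_def by (intro INF_greatest) (auto simp: abs_minus_commute)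
  then show ?thesis using \<phi>(2) by (simp add: lipschitz1_functions_def)
qed

section \<open>Bump functions and the separation of points\<close>

lemma has_real_derivative_max_0_power2:
  "((\<lambda>u. (max 0 u)\<^sup>2) has_real_derivative 2 * max 0 u) (at u)"
proof -
  consider "u > 0" | "u < 0" | "u = 0" by linarith
  then show ?thesis
  proof cases
    case 1
    have "((\<lambda>u::real. u\<^sup>2) has_real_derivative 2 * max 0 u) (at u)"
      using 1 by (auto intro!: derivative_eq_intros)
    then show ?thesis
      by (rule has_field_derivative_transform_within_open[of _ _ _ "{0<..}"]) (use 1 in auto)
  next
    case 2
    have "((\<lambda>u::real. 0) has_real_derivative 2 * max 0 u) (at u)"
      using 2 by (auto intro!: derivative_eq_intros)
    then show ?thesis
      by (rule has_field_derivative_transform_within_open[of _ _ _ "{..<0}"]) (use 2 in auto)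
  next
    case 3
    \<comment> \<open>Squaring removes the kink of \<open>max 0\<close>: the difference quotient at
      0 is bounded by the absolute value of \<open>h\<close>.\<close>
    have "((\<lambda>h::real. ((max 0 h)\<^sup>2) / h) \<longlongrightarrow> 0) (at 0)"
    proof (rule Lim_null_comparison)
      show "\<forall>\<^sub>F h::real in at 0. norm ((max 0 h)\<^sup>2 / h) \<le> \<bar>h\<bar>"
        by (auto simp: eventually_at_filter max_def power2_eq_square)
      show "((\<lambda>h::real. \<bar>h\<bar>) \<longlongrightarrow> 0) (at 0)" by (intro tendsto_rabs_zero tendsto_ident_at)
    qed
    then show ?thesis using 3 by (simp add: DERIV_def)
  qed
qed

text \<open>The function vanishes outside the ball of radius \<open>\<delta>\<close> around
  \<open>a\<close>; the outer square makes it differentiable across the boundary sphere.\<close>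

lemma has_derivative_bump:
  fixes a z :: "'a::real_inner"
  shows "((\<lambda>z. \<kappa> * (max 0 (\<delta>\<^sup>2 - (norm (z - a))\<^sup>2))\<^sup>2) has_derivative
    (\<lambda>v. \<kappa> * (2 * max 0 (\<delta>\<^sup>2 - (norm (z - a))\<^sup>2) * (- 2 * ((z - a) \<bullet> v))))) (at z)"
proof -
  have "((\<lambda>z. \<delta>\<^sup>2 - (norm (z - a))\<^sup>2) has_derivative (\<lambda>v. - 2 * ((z - a) \<bullet> v))) (at z)"
    unfolding power2_norm_eq_inner
    by (rule derivative_eq_intros refl | simp add: inner_commute)+
  from has_derivative_compose[OF this
      has_real_derivative_max_0_power2[unfolded has_field_derivative_def]]
  show ?thesis by (intro has_derivative_mult_right) simp
qed

text \<open>Inside the ball the truncated factor is at most the square of \<open>\<delta>\<close>,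
  and Cauchy-Schwarz contributes one more factor \<open>\<delta>\<close>; outside the truncated
  factor is zero.\<close>

lemma bump_gradient_bound:
  fixes a z v :: "'a::real_inner"
  assumes "0 \<le> \<kappa>" "0 \<le> \<delta>"
  shows "\<bar>\<kappa> * (2 * max 0 (\<delta>\<^sup>2 - (norm (z - a))\<^sup>2) * (- 2 * ((z - a) \<bullet> v)))\<bar>
    \<le> 4 * \<kappa> * \<delta> ^ 3 * norm v"
proof (cases "norm (z - a) \<le> \<delta>")
  case True
  have "\<bar>max 0 (\<delta>\<^sup>2 - (norm (z - a))\<^sup>2)\<bar> * \<bar>(z - a) \<bullet> v\<bar> \<le> \<delta>\<^sup>2 * (\<delta> * norm v)"
  proof (rule mult_mono)
    show "\<bar>(z - a) \<bullet> v\<bar> \<le> \<delta> * norm v"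
      using Cauchy_Schwarz_ineq2[of "z - a" v] mult_right_mono[OF True norm_ge_zero[of v]] by linarith
  qed auto
  then have "\<kappa> * (\<bar>max 0 (\<delta>\<^sup>2 - (norm (z - a))\<^sup>2)\<bar> * \<bar>(z - a) \<bullet> v\<bar>) \<le> \<kappa> * (\<delta>\<^sup>2 * (\<delta> * norm v))"
    using assms(1) by (rule mult_left_mono)
  moreover have "\<bar>\<kappa> * (2 * max 0 (\<delta>\<^sup>2 - (norm (z - a))\<^sup>2) * (- 2 * ((z - a) \<bullet> v)))\<bar> =
      4 * (\<kappa> * (\<bar>max 0 (\<delta>\<^sup>2 - (norm (z - a))\<^sup>2)\<bar> * \<bar>(z - a) \<bullet> v\<bar>))"
    using assms(1) by (simp add: abs_mult)
  moreover have "4 * \<kappa> * \<delta> ^ 3 * norm v = 4 * (\<kappa> * (\<delta>\<^sup>2 * (\<delta> * norm v)))"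
    by (simp add: power2_eq_square power3_eq_cube)
  ultimately show ?thesis by linarith
next
  case False
  then have "\<delta>\<^sup>2 \<le> (norm (z - a))\<^sup>2" using assms(2) by (intro power_mono) auto
  then show ?thesis using assms by simp
qed

text \<open>The metric attains a positive minimum on the compact product of \<open>K\<close> with
  the unit sphere; homogeneity extends the bound to all vectors. This compares the Riemannian norm
  with the Euclidean norm of the chart.\<close>

lemma tangent_norm_lower_bound:
  assumes A: "smooth_atlas A" "riemannian_metric A G" "c \<in> A"
    and K: "compact K" "K \<subseteq> snd c ` fst c" "K \<noteq> {}"
  obtains m where "m > 0" "\<And>z v. z \<in> K \<Longrightarrow> m * norm v \<le> tangent_norm G c (chart_inv c z) v"
proof -
  define F where "F = (\<lambda>x. G c (chart_inv c (fst x)) (snd x) (snd x))"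
  have inv: "chart_inv c z \<in> fst c" if "z \<in> K" for z
    using that K(2) smooth_atlasD(5)[OF A(1,3)] by auto
  have pos: "v \<noteq> 0 \<Longrightarrow> G c (chart_inv c z) v v > 0" and bil: "bilinear (G c (chart_inv c z))"
    if "z \<in> K" for z v
    using riemannian_metricD[OF A(2,3) inv[OF that]] by auto
  let ?X = "K \<times> sphere (0 :: real ^ 'b) 1"
  have chart: "continuous_on ?X (\<lambda>x. chart_inv c (fst x))"
    by (rule continuous_on_compose2[OF continuous_on_subset[OF smooth_atlasD(4)[OF A(1,3)] K(2)]])
      (auto intro: continuous_intros)
  have "continuous_on ?X F"
    unfolding F_def
    by (rule continuous_on_metric_tensor[OF A chart]) (use inv in \<open>auto intro: continuous_intros\<close>)
  moreover have "compact ?X" using K(1) by (intro compact_Times) auto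
  moreover have "?X \<noteq> {}" using K(3) by (auto simp: sphere_eq_empty)
  ultimately obtain x where x: "x \<in> ?X" "\<And>y. y \<in> ?X \<Longrightarrow> F x \<le> F y"
    using continuous_attains_inf by metis
  define m where "m = sqrt (F x)"
  have "fst x \<in> K" "snd x \<noteq> 0" using x(1) by (auto simp: mem_Times_iff)
  then have "F x > 0" using pos by (simp add: F_def)
  then have m: "m > 0" by (simp add: m_def)
  have "m * norm v \<le> tangent_norm G c (chart_inv c z) v" if z: "z \<in> K" for z v
  proof (cases "v = 0")
    case True
    then show ?thesis using tangent_norm_nonneg[OF A(2,3) inv[OF z]] by simp
  next
    case False
    have "F x \<le> F (z, (1 / norm v) *\<^sub>R v)" using z False by (intro x(2)) auto
    also have "\<dots> = G c (chart_inv c z) v v / (norm v)\<^sup>2"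
      using bil[OF z] by (simp add: F_def bilinear_lmul bilinear_rmul power2_eq_square)
    finally have "F x * (norm v)\<^sup>2 \<le> G c (chart_inv c z) v v"
      using False by (simp add: field_simps)
    then have "sqrt (F x * (norm v)\<^sup>2) \<le> tangent_norm G c (chart_inv c z) v"
      unfolding tangent_norm_def by (rule real_sqrt_le_mono)
    then show ?thesis by (simp add: m_def real_sqrt_mult)
  qed
  with m that show thesis by blast
qed

text \<open>A bump around \<open>p\<close> in one chart, supported away from \<open>q\<close> and
  extended by zero, separates the points. Scaling it down makes its gradient at most 1 in the
  Riemannian norm.\<close>

lemma lipschitz1_functions_separate_points:
  assumes A: "smooth_atlas A" "riemannian_metric A G" and "p \<noteq> q"
  obtains \<phi> where "\<phi> \<in> lipschitz1_functions A G" "continuous_on UNIV \<phi>" "\<phi> p \<noteq> \<phi> q"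
proof -
  obtain c where c: "c \<in> A" "p \<in> fst c" using smooth_atlas_chart[OF A(1)] .
  note cD = smooth_atlasD[OF A(1) c(1)]
  define a where "a = snd c p"
  define W where "W = snd c ` fst c \<inter> chart_inv c -` (- {q})"
  have "open W" unfolding W_def by (rule continuous_open_preimage[OF cD(4,2)]) auto
  moreover have "a \<in> W" using c cD(5) \<open>p \<noteq> q\<close> by (auto simp: W_def a_def)
  ultimately obtain \<delta> where \<delta>: "\<delta> > 0" "cball a \<delta> \<subseteq> W" using open_contains_cball by blast
  have sub: "cball a \<delta> \<subseteq> snd c ` fst c" using \<delta>(2) by (auto simp: W_def)
  obtain m where m: "m > 0"
    "\<And>z v. z \<in> cball a \<delta> \<Longrightarrow> m * norm v \<le> tangent_norm G c (chart_inv c z) v"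
    using tangent_norm_lower_bound[OF A c(1) compact_cball sub] \<delta>(1) by auto
  define K where "K = chart_inv c ` cball a \<delta>"
  have "compact K"
    unfolding K_def by (intro compact_continuous_image continuous_on_subset[OF cD(4) sub] compact_cball)
  \<comment> \<open>Compact sets are closed because the manifold is Hausdorff. The complement of
    \<open>K\<close> is therefore open, which allows the extension by zero to be checked
    locally.\<close>
  then have K: "closed K" by (rule compact_imp_closed)
  have K_iff: "r \<in> K \<longleftrightarrow> r \<in> fst c \<and> snd c r \<in> cball a \<delta>" for r
    unfolding K_def using sub cD(5) by (force simp del: mem_cball)
  \<comment> \<open>The first term bounds the gradient by the constant \<open>m\<close> of the
    metric, the second bounds the values by 1.\<close>
  define \<kappa> where "\<kappa> = min (m / (4 * \<delta> ^ 3)) (1 / \<delta> ^ 4)"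
  have \<kappa>: "\<kappa> > 0" "4 * \<kappa> * \<delta> ^ 3 \<le> m" "\<kappa> * \<delta> ^ 4 \<le> 1"
    using m(1) \<delta>(1) by (auto simp: \<kappa>_def min_def field_simps)
  define \<psi> where "\<psi> z = \<kappa> * (max 0 (\<delta>\<^sup>2 - (norm (z - a))\<^sup>2))\<^sup>2" for z
  define \<phi> where "\<phi> r = (if r \<in> fst c then \<psi> (snd c r) else 0)" for r
  have \<psi>_zero: "\<psi> z = 0" if "z \<notin> cball a \<delta>" for z
  proof -
    have "\<delta> \<le> norm (z - a)" using that by (simp add: dist_norm norm_minus_commute)
    then have "\<delta>\<^sup>2 \<le> (norm (z - a))\<^sup>2" using \<delta>(1) by (intro power_mono) auto
    then show ?thesis by (simp add: \<psi>_def)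
  qed
  have \<phi>_zero: "\<phi> r = 0" if "r \<notin> K" for r
    using that \<psi>_zero by (auto simp: \<phi>_def K_iff)
  have \<psi>_bounds: "0 \<le> \<psi> z" "\<psi> z \<le> 1" for z
  proof -
    show "0 \<le> \<psi> z" using \<kappa>(1) by (simp add: \<psi>_def)
    have "(max 0 (\<delta>\<^sup>2 - (norm (z - a))\<^sup>2))\<^sup>2 \<le> (\<delta>\<^sup>2)\<^sup>2" by (intro power_mono) auto
    then have "\<psi> z \<le> \<kappa> * (\<delta>\<^sup>2)\<^sup>2"
      unfolding \<psi>_def using \<kappa>(1) by (intro mult_left_mono) auto
    then show "\<psi> z \<le> 1" using \<kappa>(3) by (simp flip: power_mult)
  qed
  have "continuous_on (fst c) \<phi>"
  proof (rule continuous_on_eq)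
    show "continuous_on (fst c) (\<lambda>r. \<psi> (snd c r))"
      unfolding \<psi>_def by (intro continuous_intros cD(3))
  qed (simp add: \<phi>_def)
  \<comment> \<open>The chart domain and the complement of \<open>K\<close> are open and cover the
    manifold, so continuity on each suffices.\<close>
  moreover have "continuous_on (- K) \<phi>"
    by (rule continuous_on_eq[of _ "\<lambda>_. 0"]) (auto simp: \<phi>_zero)
  ultimately have "continuous_on (fst c \<union> - K) \<phi>"
    using cD(1) K by (intro continuous_on_open_Un) auto
  moreover have "fst c \<union> - K = UNIV" using K_iff by auto
  ultimately have cont: "continuous_on UNIV \<phi>" by simp
  have "\<phi> \<in> lipschitz1_functions A G"
  proof (rule lipschitz1_functionsI[OF A cont])
    show "range \<phi> \<subseteq> {-1..1}"
      using \<psi>_bounds order_trans[of "-1" 0 "\<psi> _"] by (auto simp: \<phi>_def)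
    fix r
    show "\<exists>d\<in>A. r \<in> fst d \<and> (\<exists>\<phi>'. ((\<phi> \<circ> chart_inv d) has_derivative \<phi>') (at (snd d r)) \<and>
      (\<forall>v. \<bar>\<phi>' v\<bar> \<le> tangent_norm G d r v))"
    proof (cases "r \<in> K")
      case True
      then have r: "r \<in> fst c" "snd c r \<in> cball a \<delta>" by (auto simp: K_iff)
      let ?D = "\<lambda>v. \<kappa> * (2 * max 0 (\<delta>\<^sup>2 - (norm (snd c r - a))\<^sup>2) * (- 2 * ((snd c r - a) \<bullet> v)))"
      have "(\<psi> has_derivative ?D) (at (snd c r))"
        unfolding \<psi>_def by (rule has_derivative_bump)
      then have "((\<phi> \<circ> chart_inv c) has_derivative ?D) (at (snd c r))"
        by (rule has_derivative_transform_within_open[OF _ cD(2)])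
          (use r cD(5) in \<open>auto simp: \<phi>_def\<close>)
      moreover have "\<bar>?D v\<bar> \<le> tangent_norm G c r v" for v
      proof -
        have "\<bar>?D v\<bar> \<le> 4 * \<kappa> * \<delta> ^ 3 * norm v"
          using \<kappa>(1) \<delta>(1) by (intro bump_gradient_bound) auto
        also have "\<dots> \<le> m * norm v" using \<kappa>(2) by (intro mult_right_mono) auto
        also have "\<dots> \<le> tangent_norm G c r v" using m(2)[OF r(2)] cD(5)[OF r(1)] by simp
        finally show ?thesis .
      qed
      ultimately show ?thesis using c(1) r(1) by blast
    next
      case False
      \<comment> \<open>Off \<open>K\<close> the function is zero in a neighbourhood, so any chart
        \<open>d\<close> at \<open>r\<close> gives the derivative zero.\<close>
      obtain d where d: "d \<in> A" "r \<in> fst d" using smooth_atlas_chart[OF A(1)] .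
      note dD = smooth_atlasD[OF A(1) d(1)]
      let ?W = "snd d ` fst d \<inter> chart_inv d -` (- K)"
      have "open ?W" by (rule continuous_open_preimage[OF dD(4,2)]) (use K in auto)
      then have "((\<phi> \<circ> chart_inv d) has_derivative (\<lambda>_. 0)) (at (snd d r))"
        by (rule has_derivative_transform_within_open[OF has_derivative_const[of 0]])
          (use d(2) dD(5) False in \<open>auto simp: \<phi>_zero\<close>)
      moreover have "\<forall>v. \<bar>0 :: real\<bar> \<le> tangent_norm G d r v"
        using tangent_norm_nonneg[OF A(2) d] by simp
      ultimately show ?thesis using d by blast
    qed
  qed
  moreover have "\<phi> p > 0" using c \<kappa>(1) \<delta>(1) by (simp add: \<phi>_def \<psi>_def a_def)
  moreover have "q \<notin> K" using \<delta>(2) by (auto simp: K_def W_def)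
  then have "\<phi> q = 0" by (rule \<phi>_zero)
  ultimately show thesis using cont that by fastforce
qed

section \<open>Empirical measures and the full shift\<close>

lemma cesaro_mean_tendsto:
  fixes u :: "nat \<Rightarrow> real"
  assumes "u \<longlonglongrightarrow> L"
  shows "(\<lambda>m. (\<Sum>i<m. u i) / real m) \<longlonglongrightarrow> L"
proof (rule LIMSEQ_I)
  fix e :: real assume e: "e > 0"
  obtain N where N: "\<And>i. i \<ge> N \<Longrightarrow> norm (u i - L) < e / 2"
    using LIMSEQ_D[OF assms, of "e / 2"] e by auto
  define S where "S = (\<Sum>i<N. \<bar>u i - L\<bar>)"
  \<comment> \<open>Chosen so that the total error \<open>S\<close> of the first \<open>N\<close>
    terms is below half of the allowed error once \<open>m\<close> exceeds \<open>K\<close>.\<close>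
  obtain K :: nat where K: "real K > 2 * S / e" using reals_Archimedean2 by blast
  show "\<exists>M. \<forall>m\<ge>M. norm ((\<Sum>i<m. u i) / real m - L) < e"
  proof (intro exI allI impI)
    fix m assume m: "m \<ge> N + K + 1"
    have mpos: "real m > 0" using m by auto
    have "(\<Sum>i<m. \<bar>u i - L\<bar>) = S + (\<Sum>i\<in>{N..<m}. \<bar>u i - L\<bar>)"
      unfolding S_def using m
      by (subst sum.union_disjoint[symmetric]) (auto intro!: sum.cong)
    also have "(\<Sum>i\<in>{N..<m}. \<bar>u i - L\<bar>) \<le> (\<Sum>i\<in>{N..<m}. e / 2)"
      using N by (intro sum_mono) (auto simp: less_imp_le)
    also have "\<dots> \<le> real m * (e / 2)" using e by (simp add: mult_right_mono)
    finally have "(\<Sum>i<m. \<bar>u i - L\<bar>) \<le> S + real m * (e / 2)" by simp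
    moreover have "S < real m * (e / 2)"
    proof -
      have "2 * S / e < real m" using K m by linarith
      then show ?thesis using e by (simp add: field_simps)
    qed
    ultimately have "(\<Sum>i<m. \<bar>u i - L\<bar>) < real m * e" by simp
    moreover have "\<bar>(\<Sum>i<m. u i) - real m * L\<bar> \<le> (\<Sum>i<m. \<bar>u i - L\<bar>)"
      using sum_abs[of "\<lambda>i. u i - L" "{..<m}"] by (simp add: sum_subtractf)
    moreover have "(\<Sum>i<m. u i) / real m - L = ((\<Sum>i<m. u i) - real m * L) / real m"
      using mpos by (simp add: field_simps)
    ultimately show "norm ((\<Sum>i<m. u i) / real m - L) < e"
      using mpos by (simp add: abs_divide pos_divide_less_eq mult.commute)
  qed
qed

text \<open>The push-forward of the uniform measure on the times below \<open>m\<close> has the same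
  values on Borel sets. Being a measure by construction, it makes integrals and total mass
  computable.\<close>

lemma empirical_measure_eq_distr:
  assumes "m > 0"
  shows "empirical_measure m y g =
    distr (uniform_count_measure {..<m}) borel (\<lambda>i. (g ^^ i) y)"
    (is "_ = ?D")
proof -
  have "emeasure ?D B = (\<Sum>i<m. emeasure (return borel ((g ^^ i) y)) B) / of_nat m"
    if B: "B \<in> sets borel" for B
  proof -
    have "emeasure ?D B = ennreal (real (card {i\<in>{..<m}. (g ^^ i) y \<in> B}) / real m)"
      using B assms
      by (simp add: emeasure_distr space_uniform_count_measure emeasure_uniform_count_measure
          vimage_def Int_def conj_commute subset_iff cong: conj_cong)
    also have "\<dots> = of_nat (card {i\<in>{..<m}. (g ^^ i) y \<in> B}) / of_nat m"
      using assms by (simp add: divide_ennreal[symmetric] ennreal_of_nat_eq_real_of_nat)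
    also have "of_nat (card {i\<in>{..<m}. (g ^^ i) y \<in> B}) =
        (\<Sum>i<m. emeasure (return borel ((g ^^ i) y)) B)"
      using B by (simp add: indicator_def of_bool_def sum.If_cases Int_def)
    finally show ?thesis .
  qed
  \<comment> \<open>\<open>measure_of\<close> depends only on the values on Borel sets, and applied
    to the values of a Borel measure it returns that measure.\<close>
  then have "empirical_measure m y g = measure_of UNIV (sets borel) (emeasure ?D)"
    unfolding empirical_measure_def
    by (intro measure_of_eq) (auto simp: sets.sigma_sets_eq[of borel, simplified])
  also have "\<dots> = ?D"
    using measure_of_of_measure[of ?D] by simp
  finally show ?thesis .
qed

lemma integral_empirical_measure:
  fixes \<phi> :: "'m::topological_space \<Rightarrow> real"
  assumes "m > 0" "\<phi> \<in> borel_measurable borel"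
  shows "(\<integral>p. \<phi> p \<partial>empirical_measure m y g) = (\<Sum>i<m. \<phi> ((g ^^ i) y)) / real m"
  using assms
  by (simp add: empirical_measure_eq_distr integral_distr lebesgue_integral_point_measure_finite
      uniform_count_measure_def sum_divide_distrib)

lemma prob_space_empirical_measure:
  assumes "m > 0"
  shows "prob_space (empirical_measure m y g)"
proof -
  have "prob_space (uniform_count_measure {..<m})"
    using assms by (intro prob_space_uniform_count_measure) auto
  then show ?thesis
    unfolding empirical_measure_eq_distr[OF assms] by (rule prob_space.prob_space_distr) simp
qed

lemma (in prob_space) abs_integral_le_bound:
  fixes \<phi> :: "'a \<Rightarrow> real"
  assumes "\<And>p. \<bar>\<phi> p\<bar> \<le> B"
  shows "\<bar>\<integral>p. \<phi> p \<partial>M\<bar> \<le> B"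
proof (cases "integrable M \<phi>")
  case True
  have "\<bar>\<integral>p. \<phi> p \<partial>M\<bar> \<le> (\<integral>p. \<bar>\<phi> p\<bar> \<partial>M)"
    by (rule integral_abs_bound)
  also have "\<dots> \<le> (\<integral>p. B \<partial>M)"
    using assms by (intro integral_mono integrable_abs True) auto
  finally show ?thesis by (simp add: prob_space)
next
  case False
  \<comment> \<open>A non-integrable function has integral 0 by convention; the bound at an
    arbitrary point shows that \<open>B\<close> is nonnegative.\<close>
  then show ?thesis using assms[of undefined] by (simp add: not_integrable_integral_eq)
qed

text \<open>A real supremum dominates its members only when it is taken over a bounded set. Test
  functions have absolute value at most 1, so 2 is a bound for the differences of their
  integrals.\<close>

lemma abs_integral_diff_le_wasserstein:
  assumes "prob_space \<mu>" "prob_space \<nu>" "\<phi> \<in> lipschitz1_functions A G"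
  shows "\<bar>(\<integral>p. \<phi> p \<partial>\<mu>) - (\<integral>p. \<phi> p \<partial>\<nu>)\<bar> \<le> wasserstein A G \<mu> \<nu>"
  unfolding wasserstein_def
proof (rule cSUP_upper[OF assms(3)], rule bdd_aboveI2)
  fix \<psi> assume "\<psi> \<in> lipschitz1_functions A G"
  then have "range \<psi> \<subseteq> {-1..1}" by (simp add: lipschitz1_functions_def)
  then have "\<bar>\<psi> p\<bar> \<le> 1" for p by (auto simp: abs_le_iff image_subset_iff minus_le_iff)
  then show "\<bar>(\<integral>p. \<psi> p \<partial>\<mu>) - (\<integral>p. \<psi> p \<partial>\<nu>)\<bar> \<le> 2"
    using prob_space.abs_integral_le_bound[OF assms(1), of \<psi> 1]
      prob_space.abs_integral_le_bound[OF assms(2), of \<psi> 1] by fastforce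
qed

text \<open>The integrals of \<open>\<phi>\<close> are averages along orbits, hence Cesaro means
  converging to \<open>\<phi> p\<close> and \<open>\<phi> q\<close>. Comparing both with the orbit
  of \<open>w\<close> by the triangle inequality shows that their difference tends to zero.\<close>

lemma lipschitz1_limits_eq:
  assumes \<phi>: "\<phi> \<in> lipschitz1_functions A G" "continuous_on UNIV \<phi>"
    and W: "(\<lambda>m. wasserstein A G (empirical_measure m y g) (empirical_measure m w g)) \<longlonglongrightarrow> 0"
      "(\<lambda>m. wasserstein A G (empirical_measure m z g) (empirical_measure m w g)) \<longlonglongrightarrow> 0"
    and y: "(\<lambda>i. (g ^^ i) y) \<longlonglongrightarrow> p" and z: "(\<lambda>i. (g ^^ i) z) \<longlonglongrightarrow> q"
  shows "\<phi> p = \<phi> q"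
proof -
  define I where "I v m = (\<integral>p. \<phi> p \<partial>empirical_measure m v g)" for v m
  have lim: "I v \<longlonglongrightarrow> \<phi> l" if "(\<lambda>i. (g ^^ i) v) \<longlonglongrightarrow> l" for v l
  proof -
    have "(\<lambda>i. \<phi> ((g ^^ i) v)) \<longlonglongrightarrow> \<phi> l"
      using \<phi>(2) that by (rule continuous_on_tendsto_compose) auto
    then have "(\<lambda>m. (\<Sum>i<m. \<phi> ((g ^^ i) v)) / real m) \<longlonglongrightarrow> \<phi> l"
      by (rule cesaro_mean_tendsto)
    moreover have "\<forall>\<^sub>F m in sequentially. (\<Sum>i<m. \<phi> ((g ^^ i) v)) / real m = I v m"
      using eventually_gt_at_top[of 0]
      by eventually_elim
        (simp add: I_def integral_empirical_measure borel_measurable_continuous_onI[OF \<phi>(2)])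
    ultimately show ?thesis by (rule Lim_transform_eventually)
  qed
  have "\<forall>\<^sub>F m in sequentially. norm (I y m - I z m) \<le>
      wasserstein A G (empirical_measure m y g) (empirical_measure m w g) +
      wasserstein A G (empirical_measure m z g) (empirical_measure m w g)"
    using eventually_gt_at_top[of 0]
  proof eventually_elim
    case (elim m)
    have "\<bar>I v m - I w m\<bar> \<le> wasserstein A G (empirical_measure m v g) (empirical_measure m w g)" for v
      unfolding I_def using elim
      by (intro abs_integral_diff_le_wasserstein \<phi>(1) prob_space_empirical_measure)
    from this[of y] this[of z] show ?case by (simp add: abs_le_iff)
  qed
  then have "(\<lambda>m. I y m - I z m) \<longlonglongrightarrow> 0"
    by (rule Lim_null_comparison) (rule tendsto_add_zero[OF W])
  moreover have "(\<lambda>m. I y m - I z m) \<longlonglongrightarrow> \<phi> p - \<phi> q"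
    by (intro tendsto_diff lim y z)
  ultimately show ?thesis using LIMSEQ_unique by fastforce
qed

section \<open>Convergence and asymptotic points in the full shift\<close>

lemma shift_funpow: "(shift ^^ k) a = (\<lambda>i. a (i + int k))"
  by (induction k) (auto simp: shift_def algebra_simps)

lemma topspace_full_shift_space: "topspace (full_shift_space n) = {a. \<forall>i. a i < n}"
  by (auto simp: full_shift_space_def)

text \<open>In a product of discrete spaces convergence means that each coordinate is eventually
  constant, from an index that may depend on the coordinate. The first conjunct is the demand that
  the sequence eventually lie in the space.\<close>

lemma limitin_full_shift_space:
  "limitin (full_shift_space n) u l sequentially \<longleftrightarrow>
    (\<forall>\<^sub>F k in sequentially. \<forall>i. u k i < n) \<and> (\<forall>i. l i < n \<and> (\<forall>\<^sub>F k in sequentially. u k i = l i))"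
proof -
  have *: "limitin (discrete_topology {..<n}) v a sequentially \<longleftrightarrow>
      a < n \<and> (\<forall>\<^sub>F k in sequentially. v k = a)" for v and a :: nat
    unfolding limitin_def by (auto elim: eventually_mono)
  show ?thesis
    by (auto simp: full_shift_space_def limitin_componentwise * PiE_UNIV_domain Pi_iff)
qed

text \<open>A point of the open set is moved slightly by replacing a far right tail of its symbol
  sequence by a constant one.\<close>

lemma shift_factor_dense_asymptotic:
  fixes k :: "(int \<Rightarrow> nat) \<Rightarrow> 'm::topological_space"
  assumes k: "continuous_map (full_shift_space n) euclidean k"
    and conj: "\<And>a. a \<in> topspace (full_shift_space n) \<Longrightarrow> k (shift a) = g (k a)"
    and D: "open D" "b \<in> topspace (full_shift_space n)" "k b \<in> D" and s: "s < n"
  obtains y where "y \<in> D" "(\<lambda>i. (g ^^ i) y) \<longlonglongrightarrow> k (\<lambda>_. s)"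
proof -
  define t where "t N i = (if i < int N then b i else s)" for N i
  have b: "b i < n" for i using D(2) by (simp add: topspace_full_shift_space)
  have t_top: "t N \<in> topspace (full_shift_space n)" for N
    using b s by (simp add: topspace_full_shift_space t_def)
  have lim: "(k \<circ> u) \<longlonglongrightarrow> k l" if "limitin (full_shift_space n) u l sequentially" for u l
    using continuous_map_limit[OF k that] by simp
  have "\<forall>\<^sub>F N in sequentially. t N i = b i" for i
    using eventually_gt_at_top[of "nat i"] by eventually_elim (auto simp: t_def)
  then have "limitin (full_shift_space n) t b sequentially"
    using b t_top by (simp add: limitin_full_shift_space topspace_full_shift_space)
  then have "\<forall>\<^sub>F N in sequentially. (k \<circ> t) N \<in> D"
    using lim topological_tendstoD D by blast
  then obtain N where N: "k (t N) \<in> D" by (auto simp: eventually_sequentially)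
  \<comment> \<open>Membership in the shift space is carried through the induction because the
    conjugacy equation holds only there.\<close>
  have iter: "(shift ^^ i) (t N) \<in> topspace (full_shift_space n) \<and>
      (g ^^ i) (k (t N)) = k ((shift ^^ i) (t N))" for i
  proof (induction i)
    case (Suc i)
    have "shift a \<in> topspace (full_shift_space n)" if "a \<in> topspace (full_shift_space n)" for a
      using that by (simp add: topspace_full_shift_space shift_def)
    then show ?case using Suc conj by simp
  qed (use t_top in simp)
  \<comment> \<open>From this index on, \<open>i + j\<close> is at least \<open>N\<close> even for
    negative \<open>i\<close>, so the coordinate is read off the constant tail.\<close>
  have "\<forall>\<^sub>F j in sequentially. (shift ^^ j) (t N) i = s" for i
    using eventually_ge_at_top[of "N + nat (- i)"]
    by eventually_elim (auto simp: t_def shift_funpow)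
  then have "limitin (full_shift_space n) (\<lambda>j. (shift ^^ j) (t N)) (\<lambda>_. s) sequentially"
    using iter s by (simp add: limitin_full_shift_space topspace_full_shift_space)
  from lim[OF this] have "(\<lambda>i. (g ^^ i) (k (t N))) \<longlonglongrightarrow> k (\<lambda>_. s)"
    using iter by (simp add: o_def)
  with N that show thesis by blast
qed

section \<open>Disjointness of the open set from the continued hyperbolic set\<close>

theorem proposition1p3:
  fixes A :: "('m::t2_space, 'n::finite) chart set"
    and G :: "('m, 'n) metric_tensor"
    and r :: enat
    and f :: "'m \<Rightarrow> 'm"
    and \<Lambda> :: "'m set"
    and V :: "nat \<Rightarrow> 'm set"
    and n :: nat
    and x :: 'm
  assumes "compact_riemannian_manifold A G"
    and "CARD('n) \<ge> 2"
    and "r \<ge> 1"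
    and "f \<in> Diff A r"
    and "hyperbolic_set A G f \<Lambda>"
    and "n \<ge> 2"
    and "\<And>i. i < n \<Longrightarrow> open (V i)"
    and "disjoint_family_on V {..<n}"
    and "maximal_invariant_set f (\<Union>i<n. V i) \<Lambda>"
    and "conjugate_to_full_shift f \<Lambda> n"
    and "x \<in> \<Lambda>"
  shows "\<exists>\<epsilon>>0. \<exists>\<U>. openin (Cr_topology A r) \<U> \<and> f \<in> \<U> \<and>
           (\<forall>g\<in>\<U>. \<forall>\<Lambda>g h. hyperbolic_continuation A G f \<Lambda> \<epsilon> g \<Lambda>g h \<longrightarrow>
              (\<forall>D. open D \<and> emeasure (riem_volume A G) D > 0 \<and>
                   (\<forall>y\<in>D. (\<lambda>m. wasserstein A G (empirical_measure m y g)
                                                 (empirical_measure m (h x) g)) \<longlonglongrightarrow> 0)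
                 \<longrightarrow> D \<inter> \<Lambda>g = {}))"
\<comment> \<open>The contradiction is derived for an arbitrary conjugacy \<open>h\<close> onto
  \<open>\<Lambda>g\<close>, so the whole space serves as the neighbourhood of
  \<open>f\<close>.\<close>
proof (intro exI[of _ 1] conjI exI[of _ "topspace (Cr_topology A r)"] ballI allI impI)
  have A: "smooth_atlas A" "riemannian_metric A G"
    using assms(1) by (auto simp: compact_riemannian_manifold_def)
  show "f \<in> topspace (Cr_topology A r)"
  proof -
    obtain c where c: "c \<in> A" using smooth_atlas_chart[OF A(1), of x] by blast
    \<comment> \<open>For the empty compact set the closeness conditions are vacuous, and this
      subbasic neighbourhood is all of \<open>Diff A r\<close>.\<close>
    have "Cr_nbhd A r f c c {} 0 1 \<in> {Cr_nbhd A r f c d K k \<epsilon> | f c d K k \<epsilon>.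
        f \<in> Diff A r \<and> c \<in> A \<and> d \<in> A \<and> compact K \<and> K \<subseteq> fst c \<and> f ` K \<subseteq> fst d \<and>
        enat k \<le> r \<and> \<epsilon> > 0}"
      by (intro CollectI exI conjI, rule refl) (use c assms(4) in \<open>auto simp: zero_enat_def[symmetric]\<close>)
    moreover have "f \<in> Cr_nbhd A r f c c {} 0 1"
      using assms(4) by (simp add: Cr_nbhd_def)
    ultimately show ?thesis
      unfolding Cr_topology_def topology_generated_by_topspace by (rule UnionI)
  qed
  fix g \<Lambda>g h D
  assume "hyperbolic_continuation A G f \<Lambda> 1 g \<Lambda>g h"
  then obtain h' where h: "homeomorphism \<Lambda> \<Lambda>g h h'" and hg: "\<And>p. p \<in> \<Lambda> \<Longrightarrow> h (f p) = g (h p)"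
    unfolding hyperbolic_continuation_def by blast
  assume "open D \<and> emeasure (riem_volume A G) D > 0 \<and>
    (\<forall>y\<in>D. (\<lambda>m. wasserstein A G (empirical_measure m y g) (empirical_measure m (h x) g)) \<longlonglongrightarrow> 0)"
  then have D: "open D" and W: "\<And>y. y \<in> D \<Longrightarrow>
      (\<lambda>m. wasserstein A G (empirical_measure m y g) (empirical_measure m (h x) g)) \<longlonglongrightarrow> 0"
    by auto
  let ?\<Sigma> = "full_shift_space n"
  obtain \<theta> \<theta>' where \<theta>: "homeomorphic_maps (top_of_set \<Lambda>) ?\<Sigma> \<theta> \<theta>'"
    and \<theta>_conj: "\<And>p. p \<in> \<Lambda> \<Longrightarrow> \<theta> (f p) = shift (\<theta> p)"
    using assms(10) unfolding conjugate_to_full_shift_def homeomorphic_map_maps by blast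
  have \<theta>': "continuous_map ?\<Sigma> (top_of_set \<Lambda>) \<theta>'" "continuous_map (top_of_set \<Lambda>) ?\<Sigma> \<theta>"
    and \<theta>'_in: "\<And>a. a \<in> topspace ?\<Sigma> \<Longrightarrow> \<theta>' a \<in> \<Lambda>"
    and \<theta>_in: "\<And>p. p \<in> \<Lambda> \<Longrightarrow> \<theta> p \<in> topspace ?\<Sigma>"
    and \<theta>\<theta>': "\<And>a. a \<in> topspace ?\<Sigma> \<Longrightarrow> \<theta> (\<theta>' a) = a"
    and \<theta>'\<theta>: "\<And>p. p \<in> \<Lambda> \<Longrightarrow> \<theta>' (\<theta> p) = p"
    using \<theta> continuous_map_image_subset_topspace[of ?\<Sigma> "top_of_set \<Lambda>" \<theta>']
      continuous_map_image_subset_topspace[of "top_of_set \<Lambda>" ?\<Sigma> \<theta>]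
    unfolding homeomorphic_maps_def by (auto simp del: topspace_full_shift_space)
  \<comment> \<open>The coding of \<open>\<Lambda>g\<close> by symbol sequences; it is continuous
    and turns the shift into \<open>g\<close>.\<close>
  define k where "k = h \<circ> \<theta>'"
  have "continuous_map (top_of_set \<Lambda>) euclidean h"
    using homeomorphism_cont1[OF h] by simp
  then have k: "continuous_map ?\<Sigma> euclidean k"
    unfolding k_def using \<theta>'(1) by (rule continuous_map_compose[rotated])
  have k_conj: "k (shift a) = g (k a)" if "a \<in> topspace ?\<Sigma>" for a
  proof -
    \<comment> \<open>Invariance of \<open>\<Lambda>\<close> is what allows \<open>\<theta>'\<close>
      to be cancelled against \<open>\<theta>\<close> at the image point.\<close>
    have "f (\<theta>' a) \<in> \<Lambda>"
      using assms(9) \<theta>'_in[OF that] unfolding maximal_invariant_set_def by blast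
    then have "\<theta>' (shift a) = f (\<theta>' a)"
      using \<theta>'\<theta> \<theta>_conj[OF \<theta>'_in[OF that]] \<theta>\<theta>'[OF that] by metis
    then show ?thesis using hg[OF \<theta>'_in[OF that]] by (simp add: k_def)
  qed
  show "D \<inter> \<Lambda>g = {}"
  proof (rule ccontr)
    assume "D \<inter> \<Lambda>g \<noteq> {}"
    then obtain p where p: "p \<in> D" "p \<in> \<Lambda>g" by blast
    then have h'p: "h' p \<in> \<Lambda>" "h (h' p) = p"
      using h by (auto simp: homeomorphism_def)
    define b where "b = \<theta> (h' p)"
    have b: "b \<in> topspace ?\<Sigma>" "k b \<in> D"
      using h'p p(1) \<theta>_in \<theta>'\<theta> by (auto simp: b_def k_def simp del: topspace_full_shift_space)
    \<comment> \<open>As \<open>n\<close> is at least 2, the symbols 0 and 1 both exist. The same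
      open set yields a point asymptotic to each of the two coded fixed points.\<close>
    obtain y where y: "y \<in> D" "(\<lambda>i. (g ^^ i) y) \<longlonglongrightarrow> k (\<lambda>_. 0)"
      using shift_factor_dense_asymptotic[OF k k_conj D b, of 0] assms(6) by auto
    obtain z where z: "z \<in> D" "(\<lambda>i. (g ^^ i) z) \<longlonglongrightarrow> k (\<lambda>_. 1)"
      using shift_factor_dense_asymptotic[OF k k_conj D b, of 1] assms(6) by auto
    have const_in: "(\<lambda>_. 0) \<in> topspace ?\<Sigma>" "(\<lambda>_. 1) \<in> topspace ?\<Sigma>"
      using assms(6) by (auto simp: topspace_full_shift_space)
    have "k (\<lambda>_. 0) \<noteq> k (\<lambda>_. 1)"
    proof
      assume "k (\<lambda>_. 0) = k (\<lambda>_. 1)"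
      then have "\<theta>' (\<lambda>_. 0) = \<theta>' (\<lambda>_. 1)"
        using homeomorphism_apply1[OF h] \<theta>'_in const_in by (metis k_def o_apply)
      then have "(\<lambda>_::int. 0::nat) = (\<lambda>_. 1)" using \<theta>\<theta>' const_in by metis
      then show False by (simp add: fun_eq_iff)
    qed
    then obtain \<phi> where \<phi>: "\<phi> \<in> lipschitz1_functions A G" "continuous_on UNIV \<phi>"
      "\<phi> (k (\<lambda>_. 0)) \<noteq> \<phi> (k (\<lambda>_. 1))"
      using lipschitz1_functions_separate_points[OF A] by metis
    \<comment> \<open>Both points lie in \<open>D\<close>, so both empirical sequences are compared
      with the same orbit, that of \<open>h x\<close>. The separating function would then agree at
      the two fixed points.\<close>
    then show False using lipschitz1_limits_eq[OF \<phi>(1,2) W W y(2) z(2)] y(1) z(1) by blast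
  qed
qed (simp_all add: openin_topspace)

end
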